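(* Let $D\subset\mathbb R^d$ be a bounded open set. Assume there exist $\bar x\in\overline D$, $0<r_1\le r_2$, $\alpha_1,\dots,\alpha_{d-1}\in(0,2]$ and an affine transformation $A$ of $\mathbb R^d$ with $A(0)=\bar x$ such that $$D\subset A(R_{\alpha_1,\dots,\alpha_{d-1}})\cup\left(\overline B(\bar x,r_2)\setminus B(\bar x,r_1)\right).$$ Then there is a constant $c_D>0$ depending only on $D$ (and not on $n$) such that $$K_{n,D}\ge c_D\,n^{\frac1d\left(2+\sum_{i=1}^{d-1}2/\alpha_i\right)}$$ for all $n$ of the form $n=\binom{d+\ell}{\ell}$, $\ell\ge0$, where $K_{n,D}$ is associated to the space $V_n=\mathbb P_\ell$ of polynomials of total degree at most $\ell$.
   Context: For $\alpha_1,\dots,\alpha_{d-1}\in(0,2]$ the reference domain is $$R_{\alpha_1,\dots,\alpha_{d-1}}:=\left\{x\in[-1,1]^d:\ \max_{1\le i\le d-1}|x_i|^{\alpha_i}\le x_d\right\}.$$ $B(x,r)$ and $\overline B(x,r)$ denote the Euclidean open and closed balls of center $x$ and radius $r$. $D$ is equipped with the uniform probability measure $\mu_D=|D|^{-1}\chi_D\,dx$ ($|\cdot|$ is Lebesgue measure) and $L^2(D)=L^2(D,\mu_D)$. $\mathbb P_\ell$ is the space of real polynomials in $d$ variables of total degree at most $\ell$, of dimension $n=\binom{d+\ell}{\ell}$; $V_n=\mathbb P_\ell$. Define $k_{n,D}(x)=\max_{v\in V_n\setminus\{0\}}\frac{|v(x)|^2}{\|v\|_{L^2(D)}^2}$ and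 $K_{n,D}=\sup_{x\in D}k_{n,D}(x)$. *)

theory Defs
  imports "HOL-Analysis.Analysis"
begin

text \<open>
  Points of $R^d$ are vectors of type \<^typ>\<open>real ^ 'd\<close>. The index \<open>k\<close> plays the role of the
  distinguished coordinate $d$; the remaining indices \<open>- {k}\<close> are $1, \dots, d-1$.
  Only the values of \<open>\<alpha>\<close> away from \<open>k\<close> matter. The element \<open>0\<close> is inserted only to give the
  maximum of nonnegative numbers the value \<open>0\<close> when $d = 1$; for $d \ge 2$ it is redundant.
\<close>

definition ref_domain :: "'d \<Rightarrow> ('d \<Rightarrow> real) \<Rightarrow> (real ^ 'd::finite) set" where
  "ref_domain k \<alpha> =
     {x. (\<forall>i. x $ i \<in> {-1..1}) \<and> Max (insert 0 ((\<lambda>i. \<bar>x $ i\<bar> powr \<alpha> i) ` (- {k}))) \<le> x $ k}"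

definition affine_transformation :: "('a::real_vector \<Rightarrow> 'b::real_vector) \<Rightarrow> bool" where
  "affine_transformation A \<longleftrightarrow> (\<exists>L b. linear L \<and> (\<forall>x. A x = L x + b))"

definition multi_indices :: "nat \<Rightarrow> ('d::finite \<Rightarrow> nat) set" where
  "multi_indices l = {m. (\<Sum>i\<in>UNIV. m i) \<le> l}"

text \<open>The sum over \<^term>\<open>multi_indices l\<close> below is a genuine finite sum:\<close>

lemma finite_multi_indices: "finite (multi_indices l :: ('d::finite \<Rightarrow> nat) set)"
proof -
  have "m i \<le> l" if "(\<Sum>i\<in>UNIV. m i) \<le> l" for m :: "'d \<Rightarrow> nat" and i
  proof -
    have "m i \<le> (\<Sum>i\<in>UNIV. m i)"
      by (rule member_le_sum) simp_all
    with that show ?thesis by linarith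
  qed
  then have "multi_indices l \<subseteq> PiE (UNIV :: 'd set) (\<lambda>_. {..l})"
    by (simp add: multi_indices_def PiE_UNIV_domain Pi_def subset_iff)
  moreover have "finite (PiE (UNIV :: 'd set) (\<lambda>_. {..l}))"
    by (rule finite_PiE) simp_all
  ultimately show ?thesis
    by (rule finite_subset)
qed

text \<open>Polynomials (as functions on $R^d$) of total degree at most \<open>l\<close>.\<close>

definition poly_space :: "nat \<Rightarrow> (real ^ 'd::finite \<Rightarrow> real) set" where
  "poly_space l =
     {v. \<exists>c. v = (\<lambda>x. \<Sum>m\<in>multi_indices l. c m * (\<Prod>i\<in>UNIV. (x $ i) ^ m i))}"

text \<open>The norm of $L^2(D, \mu_D)$, where $\mu_D$ is the uniform probability measure on \<open>D\<close>.\<close>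

definition L2norm :: "'a::euclidean_space set \<Rightarrow> ('a \<Rightarrow> real) \<Rightarrow> real" where
  "L2norm D v = sqrt (LINT x|uniform_measure lborel D. \<bar>v x\<bar>\<^sup>2)"

text \<open>
  The suprema are taken in the extended reals, so that they are meaningful without a prior
  boundedness proof. If \<open>D\<close> is open, bounded and nonempty and \<open>V\<close> is \<^term>\<open>poly_space l\<close>, then
  the supremum in \<open>k_fun\<close> is an attained, finite maximum and \<open>K_const\<close> is finite.
\<close>

definition k_fun ::
    "('a::euclidean_space \<Rightarrow> real) set \<Rightarrow> 'a set \<Rightarrow> 'a \<Rightarrow> ereal" where
  "k_fun V D x = (SUP v \<in> V - {\<lambda>_. 0}. ereal (\<bar>v x\<bar>\<^sup>2 / (L2norm D v)\<^sup>2))"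

definition K_const :: "('a::euclidean_space \<Rightarrow> real) set \<Rightarrow> 'a set \<Rightarrow> ereal" where
  "K_const V D = (SUP x \<in> D. k_fun V D x)"

end

theory Submission
  imports Defs "HOL-Probability.Probability_Measure"
begin

text \<open>
  Testing the supremum with a single polynomial gives \<open>K \<ge> v(xbar)\<^sup>2 / \<parallel>v\<parallel>\<^sup>2\<close>; by continuity of
  \<open>v\<close> this also holds when \<open>xbar\<close> lies only in the closure of \<open>D\<close> (\<open>K_const_ge_closure\<close>). So it
  suffices to find, for each degree, a polynomial with value 1 at \<open>xbar\<close> and small norm.

  Let \<open>u\<close> be the distinguished coordinate of \<open>A\<^sup>-\<^sup>1\<close> and \<open>s\<^sub>m\<close> the polynomial of degree \<open>m\<close> with
  \<open>s\<^sub>m (sin\<^sup>2 x) = sin ((2 m + 1) x) / sin x\<close>, which is the Dirichlet kernel. Put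
  \<open>v = (s\<^sub>m (u x) / (2 m + 1))\<^sup>N (1 - \<parallel>x - xbar\<parallel>\<^sup>2 / R\<^sup>2)\<^sup>M\<^sup>m\<close>, where \<open>D\<close> has radius at most \<open>R\<close>
  about \<open>xbar\<close>, and \<open>N\<close>, \<open>M\<close> do not depend on \<open>m\<close>.

  On the part of \<open>D\<close> at distance at least \<open>r1\<close> from \<open>xbar\<close> the first factor grows at most
  exponentially in \<open>m\<close>, while the second one decays exponentially; a large \<open>M\<close> makes the decay win
  (\<open>peak_polynomial_tail_bound\<close>). Near \<open>xbar\<close> the set \<open>D\<close> is inside the image of the cusp, where
  \<open>0 \<le> u \<le> 1\<close>. There the second factor is harmless and the first one gives
  \<open>v\<^sup>2 \<le> min 1 ((m + 1)\<^sup>2 u)\<^sup>-\<^sup>N\<close> (\<open>peak_polynomial_core_bound\<close>).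

  The part \<open>u \<le> t\<close> of the cusp is contained in the image of a box of measure of order \<open>t\<^sup>\<beta>\<close> with
  \<open>\<beta> = 1 + \<Sum>\<^sub>i 1 / \<alpha>\<^sub>i\<close> (\<open>cusp_measure_bound\<close>). Cutting into dyadic layers of \<open>u\<close>, one gets
  \<open>\<parallel>v\<parallel>\<^sup>2 = O((m + 1)\<^sup>-\<^sup>2\<^sup>\<beta>)\<close> once \<open>N \<ge> \<beta> + 1\<close> (\<open>integral_le_of_dyadic_layers\<close>). As the admissible \<open>m\<close>
  is proportional to \<open>l\<close> and \<open>n \<le> (l + 1)\<^sup>d\<close>, this is the asserted power of \<open>n\<close>.
\<close>

section \<open>Polynomials of bounded total degree\<close>

definition monom_fun :: "('d::finite \<Rightarrow> nat) \<Rightarrow> real ^ 'd \<Rightarrow> real" where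
  "monom_fun m x = (\<Prod>i\<in>UNIV. (x $ i) ^ m i)"

lemma poly_space_iff:
  "v \<in> poly_space l \<longleftrightarrow> (\<exists>c. v = (\<lambda>x. \<Sum>m\<in>multi_indices l. c m * monom_fun m x))"
  by (simp add: poly_space_def monom_fun_def)

lemma poly_space_0 [simp]: "(\<lambda>x. 0) \<in> poly_space l"
  unfolding poly_space_iff by (rule exI[of _ "\<lambda>_. 0"]) simp

lemma poly_space_monom_fun:
  fixes m :: "'d::finite \<Rightarrow> nat"
  assumes "sum m UNIV \<le> l"
  shows "monom_fun m \<in> poly_space l"
proof -
  have "monom_fun m x = (\<Sum>m'\<in>multi_indices l. (if m' = m then 1 else 0) * monom_fun m' x)"
    for x :: "real ^ 'd"
    using assms by (simp add: multi_indices_def[symmetric] finite_multi_indices if_distrib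
        if_distribR sum.delta cong: if_cong) (simp add: multi_indices_def)
  then show ?thesis unfolding poly_space_iff
    by (intro exI[of _ "\<lambda>m'. if m' = m then 1 else 0"] ext)
qed

lemma poly_space_cmult:
  assumes "v \<in> poly_space l"
  shows "(\<lambda>x. a * v x) \<in> poly_space l"
proof -
  obtain c where c: "v = (\<lambda>x. \<Sum>m\<in>multi_indices l. c m * monom_fun m x)"
    using assms unfolding poly_space_iff by blast
  show ?thesis unfolding poly_space_iff c
    by (rule exI[of _ "\<lambda>m. a * c m"]) (simp add: sum_distrib_left mult.assoc)
qed

lemma poly_space_add:
  assumes "v \<in> poly_space l" "w \<in> poly_space l"
  shows "(\<lambda>x. v x + w x) \<in> poly_space l"
proof -
  obtain c c' where c: "v = (\<lambda>x. \<Sum>m\<in>multi_indices l. c m * monom_fun m x)"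
    "w = (\<lambda>x. \<Sum>m\<in>multi_indices l. c' m * monom_fun m x)"
    using assms unfolding poly_space_iff by blast
  show ?thesis unfolding poly_space_iff c
    by (rule exI[of _ "\<lambda>m. c m + c' m"]) (simp add: sum.distrib distrib_right)
qed

lemma poly_space_diff:
  assumes "v \<in> poly_space l" "w \<in> poly_space l"
  shows "(\<lambda>x. v x - w x) \<in> poly_space l"
  using poly_space_add[OF assms(1) poly_space_cmult[OF assms(2), of "-1"]] by simp

lemma poly_space_sum:
  assumes "\<And>i. i \<in> I \<Longrightarrow> v i \<in> poly_space l"
  shows "(\<lambda>x. \<Sum>i\<in>I. v i x) \<in> poly_space l"
  using assms by (induction I rule: infinite_finite_induct) (simp_all add: poly_space_add)

text \<open>
  Multi-indices add when monomials are multiplied, so expanding the product gives a combination of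
  monomials of degree at most \<open>a + b\<close>.
\<close>

lemma poly_space_mult:
  assumes "v \<in> poly_space a" "w \<in> poly_space b"
  shows "(\<lambda>x. v x * w x) \<in> poly_space (a + b)"
proof -
  obtain c c' where c: "v = (\<lambda>x. \<Sum>m\<in>multi_indices a. c m * monom_fun m x)"
    "w = (\<lambda>x. \<Sum>m\<in>multi_indices b. c' m * monom_fun m x)"
    using assms unfolding poly_space_iff by blast
  have "(\<lambda>x. v x * w x) =
    (\<lambda>x. \<Sum>m\<in>multi_indices a. \<Sum>m'\<in>multi_indices b.
       (c m * c' m') * monom_fun (\<lambda>i. m i + m' i) x)"
    unfolding c sum_product
    by (simp add: monom_fun_def power_add prod.distrib mult_ac)
  also have "\<dots> \<in> poly_space (a + b)"
    by (intro poly_space_sum poly_space_cmult poly_space_monom_fun)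
      (auto simp: multi_indices_def sum.distrib intro: add_mono)
  finally show ?thesis .
qed

lemma poly_space_mono:
  assumes "v \<in> poly_space a" "a \<le> b"
  shows "v \<in> poly_space b"
proof -
  obtain c where c: "v = (\<lambda>x. \<Sum>m\<in>multi_indices a. c m * monom_fun m x)"
    using assms unfolding poly_space_iff by blast
  show ?thesis unfolding c using assms(2)
    by (intro poly_space_sum poly_space_cmult poly_space_monom_fun) (auto simp: multi_indices_def)
qed

lemma poly_space_const: "(\<lambda>x. a) \<in> poly_space l"
  using poly_space_cmult[OF poly_space_monom_fun[of "\<lambda>_. 0" l], of a] by (simp add: monom_fun_def)

lemma poly_space_power:
  assumes "v \<in> poly_space a"
  shows "(\<lambda>x. v x ^ n) \<in> poly_space (n * a)"
proof (induction n)
  case 0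
  show ?case using poly_space_const[of 1 0] by simp
next
  case (Suc n)
  show ?case using poly_space_mult[OF assms Suc] by simp
qed

lemma poly_space_coord:
  fixes i :: "'d::finite"
  shows "(\<lambda>x. x $ i) \<in> poly_space 1"
proof -
  have "monom_fun (\<lambda>j. if j = i then 1 else 0) = (\<lambda>x. x $ i)"
    by (auto simp: monom_fun_def fun_eq_iff if_distrib[of "power _"] prod.delta cong: if_cong)
  with poly_space_monom_fun[of "\<lambda>j. if j = i then 1 else 0" 1] show ?thesis by simp
qed

lemma poly_space_linear:
  fixes f :: "real ^ 'd::finite \<Rightarrow> real"
  assumes "linear f"
  shows "f \<in> poly_space 1"
proof -
  have "f x = (\<Sum>i\<in>UNIV. f (axis i 1) * x $ i)" for x
  proof -
    have "f x = f (\<Sum>i\<in>UNIV. x $ i *\<^sub>R axis i 1)"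
      by (simp add: basis_expansion scalar_mult_eq_scaleR[symmetric])
    then show ?thesis by (simp add: linear_sum[OF assms] linear_scale[OF assms] mult.commute)
  qed
  then have "f = (\<lambda>x. \<Sum>i\<in>UNIV. f (axis i 1) * x $ i)" by blast
  also have "\<dots> \<in> poly_space 1"
    by (intro poly_space_sum poly_space_cmult poly_space_coord)
  finally show ?thesis .
qed

lemma poly_space_norm_square:
  fixes a :: "real ^ 'd::finite"
  shows "(\<lambda>x. (norm (x - a))\<^sup>2) \<in> poly_space 2"
proof -
  have "(\<lambda>x. (x $ i - a $ i)\<^sup>2) \<in> poly_space 2" for i
    using poly_space_power[OF poly_space_diff[OF poly_space_coord poly_space_const], of i "a $ i" 2]
    by simp
  then have "(\<lambda>x. \<Sum>i\<in>UNIV. (x $ i - a $ i)\<^sup>2) \<in> poly_space 2"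
    by (intro poly_space_sum)
  then show ?thesis by (simp add: norm_vec_def L2_set_def sum_nonneg)
qed

lemma continuous_on_poly_space:
  assumes "v \<in> poly_space l"
  shows "continuous_on S v"
proof -
  obtain c where c: "v = (\<lambda>x. \<Sum>m\<in>multi_indices l. c m * monom_fun m x)"
    using assms unfolding poly_space_iff by blast
  show ?thesis unfolding c monom_fun_def by (intro continuous_intros)
qed

section \<open>The Dirichlet kernel as an algebraic polynomial\<close>

text \<open>
  With \<open>t = sin\<^sup>2 x\<close> the factor \<open>2 (1 - 2 t)\<close> is \<open>2 cos (2 x)\<close>, so the recursion is the addition
  theorem \<open>sin (y + 2 x) + sin (y - 2 x) = 2 cos (2 x) sin y\<close> at \<open>y = (2 m + 3) x\<close>, divided by \<open>sin x\<close>.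
\<close>

fun sine_ratio :: "nat \<Rightarrow> real \<Rightarrow> real" where
  "sine_ratio 0 t = 1"
| "sine_ratio (Suc 0) t = 3 - 4 * t"
| "sine_ratio (Suc (Suc m)) t = 2 * (1 - 2 * t) * sine_ratio (Suc m) t - sine_ratio m t"

lemma sine_ratio_sin:
  "sin x * sine_ratio m ((sin x)\<^sup>2) = sin ((2 * real m + 1) * x)"
proof (induction m "(sin x)\<^sup>2" rule: sine_ratio.induct)
  case 2
  have "sin (3 * x) = sin (2 * x + x)" by (simp add: algebra_simps)
  also have "\<dots> = sin x * (3 - 4 * (sin x)\<^sup>2)"
    unfolding sin_add sin_double cos_double_sin
    using sin_cos_squared_add[of x] by algebra
  finally show ?case by simp
next
  case (3 m)
  have eq: "(2 * real (Suc (Suc m)) + 1) * x = (2 * real (Suc m) + 1) * x + 2 * x"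
    "(2 * real m + 1) * x = (2 * real (Suc m) + 1) * x - 2 * x"
    by (simp_all add: algebra_simps)
  have "sin x * sine_ratio (Suc (Suc m)) ((sin x)\<^sup>2)
    = 2 * cos (2 * x) * (sin x * sine_ratio (Suc m) ((sin x)\<^sup>2)) - sin x * sine_ratio m ((sin x)\<^sup>2)"
    unfolding cos_double_sin by (simp add: algebra_simps)
  also have "\<dots> = 2 * cos (2 * x) * sin ((2 * real (Suc m) + 1) * x) - sin ((2 * real m + 1) * x)"
    using 3 by simp
  also have "\<dots> = sin ((2 * real (Suc (Suc m)) + 1) * x)"
    unfolding eq sin_add sin_diff by (simp add: algebra_simps)
  finally show ?case .
qed simp

lemma sine_ratio_0: "sine_ratio m 0 = 2 * real m + 1"
  by (induction m "0::real" rule: sine_ratio.induct) simp_all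

lemma abs_sin_mult_le: "\<bar>sin (real n * x)\<bar> \<le> real n * \<bar>sin x\<bar>"
proof (induction n)
  case (Suc n)
  have "\<bar>sin (real (Suc n) * x)\<bar> = \<bar>sin (real n * x) * cos x + cos (real n * x) * sin x\<bar>"
    by (simp add: distrib_right sin_add algebra_simps)
  also have "\<dots> \<le> \<bar>sin (real n * x)\<bar> * \<bar>cos x\<bar> + \<bar>cos (real n * x)\<bar> * \<bar>sin x\<bar>"
    by (metis abs_mult abs_triangle_ineq)
  also have "\<dots> \<le> \<bar>sin (real n * x)\<bar> * 1 + 1 * \<bar>sin x\<bar>"
    by (intro add_mono mult_left_mono mult_right_mono) simp_all
  finally show ?case using Suc by (simp add: distrib_right)
qed simp

text \<open>
  Write \<open>t = sin\<^sup>2 x\<close>. The first bound is \<open>\<bar>sin\<bar> \<le> 1\<close> for the numerator of the kernel, the second one is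
  \<open>\<bar>sin (n x)\<bar> \<le> n \<bar>sin x\<bar>\<close>. The first makes the kernel decay away from \<open>0\<close> at the scale \<open>m\<^sup>-\<^sup>2\<close>, the
  second says that its maximum over the unit interval is the value at \<open>0\<close>.
\<close>

lemma sine_ratio_bounds:
  assumes "0 \<le> t" "t \<le> 1"
  shows "t * (sine_ratio m t)\<^sup>2 \<le> 1" "\<bar>sine_ratio m t\<bar> \<le> 2 * real m + 1"
proof -
  define x where "x = arcsin (sqrt t)"
  have x: "sin x = sqrt t" "(sin x)\<^sup>2 = t"
    using assms by (simp_all add: x_def order_trans[OF _ real_sqrt_ge_zero])
  have eq: "sqrt t * sine_ratio m t = sin ((2 * real m + 1) * x)"
    using sine_ratio_sin[of x m] x by simp
  have "t * (sine_ratio m t)\<^sup>2 = (sqrt t * sine_ratio m t)\<^sup>2"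
    using assms by (simp add: power_mult_distrib)
  also have "\<dots> \<le> 1" unfolding eq by (simp add: abs_square_le_1)
  finally show "t * (sine_ratio m t)\<^sup>2 \<le> 1" .
  show "\<bar>sine_ratio m t\<bar> \<le> 2 * real m + 1"
  proof (cases "t = 0")
    case True
    then show ?thesis by (simp add: sine_ratio_0)
  next
    case False
    have "sqrt t * \<bar>sine_ratio m t\<bar> = \<bar>sin (real (2 * m + 1) * x)\<bar>"
      using eq assms by (metis abs_mult abs_of_nonneg real_sqrt_ge_zero of_nat_mult of_nat_add of_nat_1 of_nat_numeral)
    also have "\<dots> \<le> real (2 * m + 1) * sqrt t"
      using abs_sin_mult_le[of "2 * m + 1" x] x assms by simp
    finally show ?thesis using assms False by (simp add: mult.commute)
  qed
qed

text \<open>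
  Outside the unit interval only a crude bound is needed: any exponential rate will be beaten by the
  cut-off factor of the peak polynomial. The hypothesis makes each step of the recursion cost at
  most a factor \<open>b\<close>.
\<close>

lemma sine_ratio_growth:
  assumes "3 + 4 * \<bar>t\<bar> \<le> b"
  shows "\<bar>sine_ratio m t\<bar> \<le> b ^ m"
  using assms
proof (induction m t rule: sine_ratio.induct)
  case (3 m t)
  have b: "1 \<le> b" using 3(3) by linarith
  have "\<bar>sine_ratio (Suc (Suc m)) t\<bar> \<le> \<bar>2 * (1 - 2 * t)\<bar> * \<bar>sine_ratio (Suc m) t\<bar> + \<bar>sine_ratio m t\<bar>"
    by (simp add: abs_mult[symmetric])
  also have "\<dots> \<le> (b - 1) * b ^ Suc m + b ^ Suc m"
  proof (intro add_mono mult_mono)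
    show "\<bar>2 * (1 - 2 * t)\<bar> \<le> b - 1" using 3(3) by (auto simp: abs_if split: if_splits)
    show "\<bar>sine_ratio (Suc m) t\<bar> \<le> b ^ Suc m" using 3 by blast
    show "\<bar>sine_ratio m t\<bar> \<le> b ^ Suc m"
      using 3(2)[OF 3(3)] power_increasing[of m "Suc m" b] b by linarith
  qed (use b in simp_all)
  also have "\<dots> = b ^ Suc (Suc m)" by (simp add: algebra_simps)
  finally show ?case .
qed auto

lemma poly_space_sine_ratio:
  assumes "u \<in> poly_space 1"
  shows "(\<lambda>x. sine_ratio m (u x)) \<in> poly_space m"
proof (induction m "undefined :: real" rule: sine_ratio.induct)
  case 1
  show ?case using poly_space_const[of 1 0] by simp
next
  case 2
  show ?case
    using poly_space_diff[OF poly_space_const poly_space_cmult[OF assms], of 3 4] by simp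
next
  case (3 m)
  have "(\<lambda>x. 2 * (1 - 2 * u x)) \<in> poly_space 1"
    by (intro poly_space_cmult poly_space_diff poly_space_const assms)
  from poly_space_mult[OF this 3(1)] show ?case
    using poly_space_diff[OF _ poly_space_mono[OF 3(2)]] by simp
qed

section \<open>Pointwise bounds for the peak polynomial\<close>

text \<open>
  In the cusp the argument \<open>t\<close> of the kernel lies in the unit interval and the cut-off \<open>w\<close> is at most
  1, so the two estimates of the kernel carry over to its powers.
\<close>

lemma peak_polynomial_core_bound:
  fixes m N j :: nat and t w :: real
  assumes "0 \<le> t" "t \<le> 1" "\<bar>w\<bar> \<le> 1"
  defines "y \<equiv> (sine_ratio m t / (2 * real m + 1)) ^ N * w ^ j"
  shows "y\<^sup>2 \<le> 1" "y\<^sup>2 * ((real m + 1)\<^sup>2 * t) ^ N \<le> 1"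
proof -
  define p where "p = sine_ratio m t / (2 * real m + 1)"
  have p1: "p\<^sup>2 \<le> 1"
    using sine_ratio_bounds(2)[OF assms(1,2), of m]
    by (simp add: p_def abs_square_le_1 abs_divide)
  have w1: "(w ^ j)\<^sup>2 \<le> 1" using power_le_one[of "\<bar>w\<bar>" j] assms(3) by (simp add: abs_square_le_1 power_abs)
  have y: "y\<^sup>2 = (p\<^sup>2) ^ N * (w ^ j)\<^sup>2"
    by (simp add: y_def p_def power_mult_distrib power_commutes mult.commute flip: power_mult)
  have le: "y\<^sup>2 \<le> (p\<^sup>2) ^ N"
    using w1 unfolding y by (intro mult_left_le) auto
  also have "\<dots> \<le> 1" using p1 by (simp add: power_le_one)
  finally show "y\<^sup>2 \<le> 1" .
  have "p\<^sup>2 * ((real m + 1)\<^sup>2 * t) = ((real m + 1) / (2 * real m + 1))\<^sup>2 * (t * (sine_ratio m t)\<^sup>2)"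
    by (simp add: p_def power_divide)
  also have "\<dots> \<le> 1 * 1"
    using sine_ratio_bounds(1)[OF assms(1,2), of m] assms(1)
    by (intro mult_mono) (auto simp: power_le_one)
  finally have pt: "p\<^sup>2 * ((real m + 1)\<^sup>2 * t) \<le> 1" by simp
  have "y\<^sup>2 * ((real m + 1)\<^sup>2 * t) ^ N \<le> (p\<^sup>2) ^ N * ((real m + 1)\<^sup>2 * t) ^ N"
    using le assms(1) by (intro mult_right_mono) auto
  also have "\<dots> = (p\<^sup>2 * ((real m + 1)\<^sup>2 * t)) ^ N" by (simp add: power_mult_distrib)
  also have "\<dots> \<le> 1" using pt assms(1) by (intro power_le_one) auto
  finally show "y\<^sup>2 * ((real m + 1)\<^sup>2 * t) ^ N \<le> 1" .
qed

text \<open>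
  Away from the peak the cut-off is at most \<open>\<rho>\<close>. The condition on \<open>N\<close> and \<open>M\<close> turns the product of the
  growth \<open>B\<^sup>m\<^sup>N\<close> and the decay \<open>\<rho>\<^sup>M\<^sup>m\<close> into \<open>2\<^sup>-\<^sup>m\<^sup>N\<close>, and \<open>m + 1 \<le> 2\<^sup>m\<close> turns this into a power of
  \<open>m + 1\<close>, in the same form as the bound in the cusp.
\<close>

lemma peak_polynomial_tail_bound:
  assumes "3 + 4 * \<bar>t\<bar> \<le> B" "\<bar>w\<bar> \<le> \<rho>" "(2 * B) ^ N * \<rho> ^ M \<le> 1"
  shows "((sine_ratio m t / (2 * real m + 1)) ^ N * w ^ (M * m))\<^sup>2 \<le> (1 / (real m + 1)\<^sup>2) ^ N"
proof -
  have "B \<ge> 3" using assms(1) by linarith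
  have "\<rho> \<ge> 0" using assms(2) by linarith
  have "\<bar>sine_ratio m t / (2 * real m + 1)\<bar> \<le> \<bar>sine_ratio m t\<bar>"
    by (simp add: abs_divide divide_le_eq mult_le_cancel_left1)
  also have "\<dots> \<le> B ^ m" using sine_ratio_growth[OF assms(1)] .
  finally have p: "\<bar>sine_ratio m t / (2 * real m + 1)\<bar> \<le> B ^ m" .
  have "\<bar>(sine_ratio m t / (2 * real m + 1)) ^ N * w ^ (M * m)\<bar>
      = \<bar>sine_ratio m t / (2 * real m + 1)\<bar> ^ N * \<bar>w\<bar> ^ (M * m)"
    by (simp add: abs_mult power_abs)
  also have "\<dots> \<le> (B ^ m) ^ N * \<rho> ^ (M * m)"
    using p assms(2) \<open>B \<ge> 3\<close> by (intro mult_mono power_mono) auto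
  also have "\<dots> = (B ^ N * \<rho> ^ M) ^ m"
    by (simp add: power_mult_distrib power_mult[symmetric] mult.commute)
  also have "\<dots> \<le> (1 / 2 ^ N) ^ m"
    using assms(3) \<open>B \<ge> 3\<close> \<open>\<rho> \<ge> 0\<close>
    by (intro power_mono) (auto simp: power_mult_distrib field_simps)
  also have "\<dots> = (1 / 2 ^ m) ^ N"
    by (simp add: power_divide power_mult[symmetric] mult.commute)
  also have "\<dots> \<le> (1 / (real m + 1)) ^ N"
  proof (intro power_mono divide_left_mono)
    have "Suc m \<le> 2 ^ m" by (induction m) auto
    then have "real (Suc m) \<le> real (2 ^ m)" by (simp only: of_nat_le_iff)
    then show "real m + 1 \<le> 2 ^ m" by simp
  qed auto
  finally have "\<bar>(sine_ratio m t / (2 * real m + 1)) ^ N * w ^ (M * m)\<bar>\<^sup>2 \<le> ((1 / (real m + 1)) ^ N)\<^sup>2"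
    by (intro power_mono) auto
  also have "\<dots> = (1 / (real m + 1)\<^sup>2) ^ N"
    by (simp add: power_divide power_mult[symmetric] mult.commute)
  finally show ?thesis by simp
qed

section \<open>Norms and the Christoffel function on open sets\<close>

lemma emeasure_lborel_open_bounded:
  fixes S :: "'a::euclidean_space set"
  assumes "open S" "bounded S" "S \<noteq> {}"
  shows "emeasure lborel S \<noteq> 0" "emeasure lborel S < \<infinity>"
proof -
  show "emeasure lborel S < \<infinity>" using emeasure_bounded_finite[OF assms(2)] by simp
  have "S \<in> sets lborel" using assms(1) by simp
  then show "emeasure lborel S \<noteq> 0"
    using open_not_negligible[OF assms(1,3)]
    by (auto simp: negligible_iff_null_sets null_sets_def)
qed

lemma prob_space_uniform_measure_open:
  fixes D :: "'a::euclidean_space set"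
  assumes "open D" "bounded D" "D \<noteq> {}"
  shows "prob_space (uniform_measure lborel D)"
  using emeasure_lborel_open_bounded[OF assms] by (intro prob_space_uniform_measure) auto

lemma integrable_uniform_measure_continuous:
  fixes D :: "'a::euclidean_space set" and f :: "'a \<Rightarrow> real"
  assumes "open D" "bounded D" "D \<noteq> {}" "continuous_on UNIV f"
  shows "integrable (uniform_measure lborel D) f"
proof -
  interpret prob_space "uniform_measure lborel D"
    by (rule prob_space_uniform_measure_open) fact+
  have "compact (f ` closure D)"
    using assms by (intro compact_continuous_image) (auto intro: continuous_on_subset simp: compact_closure)
  then obtain B where B: "\<And>x. x \<in> closure D \<Longrightarrow> norm (f x) \<le> B"
    using compact_imp_bounded[of "f ` closure D"] unfolding bounded_iff by blast
  show ?thesis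
  proof (rule integrable_const_bound)
    show "AE x in uniform_measure lborel D. norm (f x) \<le> B"
      using assms(1) B closure_subset by (intro AE_uniform_measureI AE_I2) auto
    show "f \<in> borel_measurable (uniform_measure lborel D)"
      using assms(4) borel_measurable_continuous_onI by (subst measurable_cong_sets[OF _ refl, of _ borel]) auto
  qed
qed

lemma L2norm_square:
  "(L2norm D v)\<^sup>2 = (LINT x|uniform_measure lborel D. (v x)\<^sup>2)"
  by (simp add: L2norm_def)

text \<open>
  A continuous function that vanishes almost everywhere on an open set vanishes on it. This keeps
  the quotients in \<^const>\<open>k_fun\<close> away from the conventional value of a division by zero.
\<close>

lemma L2norm_pos:
  fixes D :: "'a::euclidean_space set" and v :: "'a \<Rightarrow> real"
  assumes "open D" "bounded D" "continuous_on UNIV v" "y \<in> D" "v y \<noteq> 0"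
  shows "(L2norm D v)\<^sup>2 > 0"
proof (rule ccontr)
  assume "\<not> (L2norm D v)\<^sup>2 > 0"
  then have "(LINT x|uniform_measure lborel D. (v x)\<^sup>2) = 0"
    by (simp add: L2norm_square[symmetric])
  moreover have ne: "D \<noteq> {}" using assms(4) by blast
  have "integrable (uniform_measure lborel D) (\<lambda>x. (v x)\<^sup>2)"
    using assms ne by (intro integrable_uniform_measure_continuous continuous_intros)
  ultimately have "AE x in uniform_measure lborel D. (v x)\<^sup>2 = 0"
    by (subst (asm) integral_nonneg_eq_0_iff_AE) auto
  then have "AE x in lborel. x \<in> D \<longrightarrow> (v x)\<^sup>2 = 0"
    unfolding AE_uniform_measure[OF emeasure_lborel_open_bounded[OF assms(1,2) ne]] .
  then have ae: "AE x in lborel. x \<notin> {x \<in> D. v x \<noteq> 0}" by (auto elim: eventually_mono)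
  have "{x \<in> D. v x \<noteq> 0} = D \<inter> v -` (- {0})" by auto
  then have op: "open {x \<in> D. v x \<noteq> 0}"
    using assms(1,3) by (auto intro: open_Int open_vimage)
  then have "{x \<in> D. v x \<noteq> 0} \<in> null_sets lborel"
    using AE_iff_null_sets[of "{x \<in> D. v x \<noteq> 0}" lborel] ae by simp
  moreover have "bounded {x \<in> D. v x \<noteq> 0}" using assms(2) by (rule bounded_subset) auto
  ultimately show False
    using emeasure_lborel_open_bounded(1)[OF op] assms(4,5) by auto
qed

text \<open>
  Evaluate the quotient for \<open>v\<close> along a sequence in \<open>D\<close> that converges to \<open>x\<close>.
\<close>

lemma K_const_ge_closure:
  fixes D :: "'a::euclidean_space set" and v :: "'a \<Rightarrow> real"
  assumes "open D" "bounded D" "x \<in> closure D" "v \<in> V" "continuous_on UNIV v" "v x = 1"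
    and E: "(L2norm D v)\<^sup>2 \<le> E"
  shows "ereal (1 / E) \<le> K_const V D"
proof -
  obtain y where y: "\<And>n. y n \<in> D" "y \<longlonglongrightarrow> x"
    using assms(3) unfolding closure_sequential by blast
  have vy: "(\<lambda>n. v (y n)) \<longlonglongrightarrow> 1"
    using continuous_on_tendsto_compose[OF assms(5) y(2)] assms(6) by simp
  then have "\<forall>\<^sub>F n in sequentially. v (y n) > 0" by (rule order_tendstoD) simp
  then obtain n where "v (y n) > 0" by (auto simp: eventually_sequentially)
  then have pos: "(L2norm D v)\<^sup>2 > 0"
    using assms y by (intro L2norm_pos[of _ _ "y n"]) auto
  have "v \<noteq> (\<lambda>_. 0)" using assms(6) by auto
  then have le: "ereal (\<bar>v (y n)\<bar>\<^sup>2 / (L2norm D v)\<^sup>2) \<le> K_const V D" for n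
    unfolding K_const_def k_fun_def
    by (intro SUP_upper2[OF y(1)[of n]] SUP_upper2[of v]) (use assms(4) in auto)
  have "(\<lambda>n. ereal (\<bar>v (y n)\<bar>\<^sup>2 / (L2norm D v)\<^sup>2)) \<longlonglongrightarrow> ereal (\<bar>1\<bar>\<^sup>2 / (L2norm D v)\<^sup>2)"
    using pos by (intro tendsto_ereal tendsto_intros vy) auto
  then have "ereal (1 / (L2norm D v)\<^sup>2) \<le> K_const V D"
    using LIMSEQ_le_const2 le by fastforce
  moreover have "ereal (1 / E) \<le> ereal (1 / (L2norm D v)\<^sup>2)"
    using E pos by (simp add: frac_le)
  ultimately show ?thesis by (rule order_trans[rotated])
qed

section \<open>Volume of a truncated cusp\<close>

text \<open>
  The factor is the absolute value of the determinant, but only its existence matters here, and it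
  follows from a decomposition into elementary maps without any determinant computation. This
  keeps the index type free of an ordering.
\<close>

lemma linear_image_scales_measure:
  fixes f :: "real ^ 'd::finite \<Rightarrow> real ^ 'd"
  assumes "linear f"
  obtains c where "c \<ge> 0"
    "\<And>S. S \<in> lmeasurable \<Longrightarrow> measure lebesgue (f ` S) = c * measure lebesgue S"
proof -
  have "\<exists>c\<ge>0. \<forall>S\<in>lmeasurable. f ` S \<in> lmeasurable \<and> measure lebesgue (f ` S) = c * measure lebesgue S"
  proof (induction f rule: induct_linear_elementary)
    case 1
    show ?case by fact
  next
    case (2 f g)
    then obtain c d where c: "c \<ge> 0"
        "\<forall>S\<in>lmeasurable. f ` S \<in> lmeasurable \<and> measure lebesgue (f ` S) = c * measure lebesgue S"
      and d: "d \<ge> 0"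
        "\<forall>S\<in>lmeasurable. g ` S \<in> lmeasurable \<and> measure lebesgue (g ` S) = d * measure lebesgue S"
      by blast
    show ?case
      unfolding image_comp[symmetric] using c d by (intro exI[of _ "c * d"]) simp
  next
    case (3 f i)
    have "f x \<noteq> axis i 1" for x
      using 3(2)[of x] by (metis axis_nth zero_neq_one)
    then have "\<not> inj f"
      using 3(1) linear_injective_imp_surjective by (metis surjD)
    then have "negligible (f ` S)" for S
      using 3(1) negligible_linear_singular_image by blast
    then show ?case
      by (intro exI[of _ 0]) (auto simp: negligible_iff_measure)
  next
    case (4 c)
    show ?case
      by (intro exI[of _ "\<bar>prod c UNIV\<bar>"]) (simp add: measurable_stretch measure_stretch)
  next
    case (5 m n)
    let ?h = "\<lambda>v :: real ^ 'd. \<chi> i. v $ Transposition.transpose m n i"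
    have lin: "linear ?h"
      by (rule linearI) (simp_all add: plus_vec_def scaleR_vec_def)
    have "measure lebesgue (?h ` cbox a b) = 1 * measure lebesgue (cbox a b)" for a b
    proof (cases "cbox a b = {}")
      case False
      have eq: "?h ` cbox a b = cbox (?h a) (?h b)"
        by (auto simp: image_iff lambda_swap_Galois mem_box_cart) (metis transpose_involutory)+
      then have ne: "cbox (?h a) (?h b) \<noteq> {}" using False by blast
      show ?thesis
        using prod.permute[OF permutes_swap_id, where S=UNIV and g="\<lambda>i. (b - a) $ i", symmetric]
        unfolding eq by (simp add: content_cbox_cart[OF ne] content_cbox_cart[OF False] o_def)
    qed simp
    then have "?h ` S \<in> lmeasurable \<and> measure lebesgue (?h ` S) = 1 * measure lebesgue S"
      if "S \<in> lmeasurable" for S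
      using measure_linear_sufficient[OF lin that] by metis
    then show ?case
      by (intro exI[of _ 1] conjI ballI) simp_all
  next
    case (6 m n)
    let ?h = "\<lambda>v :: real ^ 'd. \<chi> i. if i = m then v $ m + v $ n else v $ i"
    have lin: "linear ?h"
      by (rule linearI) (auto simp: algebra_simps plus_vec_def scaleR_vec_def vec_eq_iff)
    have "measure lebesgue (?h ` cbox a b) = 1 * measure lebesgue (cbox a b)" for a b
    proof (cases "cbox a b = {}")
      case False
      \<comment> \<open>A shear of a box is easiest to measure when the box starts at the origin.\<close>
      have eq: "cbox a b = (+) a ` cbox 0 (b - a)"
        using cbox_translation[of a 0 "b - a"] by simp
      then have ne: "cbox 0 (b - a) \<noteq> {}" using False by auto
      have "?h ` cbox a b = (+) (?h a) ` ?h ` cbox 0 (b - a)"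
        unfolding eq image_image linear_add[OF lin] ..
      then show ?thesis
        using measure_shear_interval[OF 6 ne] eq by (simp add: measure_translation del: measure_completion)
    qed simp
    then have "?h ` S \<in> lmeasurable \<and> measure lebesgue (?h ` S) = 1 * measure lebesgue S"
      if "S \<in> lmeasurable" for S
      using measure_linear_sufficient[OF lin that] by metis
    then show ?case
      by (intro exI[of _ 1] conjI ballI) simp_all
  qed
  then show ?thesis using that by blast
qed

lemma affine_image_compact_measure:
  fixes L :: "real ^ 'd::finite \<Rightarrow> real ^ 'd"
  assumes "linear L"
  obtains c where "c \<ge> 0" "\<And>S. compact S \<Longrightarrow> compact ((\<lambda>x. L x + b) ` S)"
    "\<And>S. compact S \<Longrightarrow> measure lborel ((\<lambda>x. L x + b) ` S) = c * measure lborel S"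
proof -
  obtain c where c: "c \<ge> 0"
    "\<And>S. S \<in> lmeasurable \<Longrightarrow> measure lebesgue (L ` S) = c * measure lebesgue S"
    using linear_image_scales_measure[OF assms] by blast
  have compact: "compact ((\<lambda>x. L x + b) ` S)" if "compact S" for S
    using assms that
    by (intro compact_continuous_image continuous_intros linear_continuous_on)
      (simp_all add: linear_conv_bounded_linear)
  have "measure lborel ((\<lambda>x. L x + b) ` S) = c * measure lborel S" if S: "compact S" for S
  proof -
    have "(\<lambda>x. L x + b) ` S = (+) b ` L ` S" by (auto simp: add.commute)
    then have "measure lebesgue ((\<lambda>x. L x + b) ` S) = c * measure lebesgue S"
      using c(2)[OF lmeasurable_compact[OF S]] by (simp add: measure_translation)
    then show ?thesis
      using borel_compact[OF compact[OF S]] borel_compact[OF S] by simp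
  qed
  with c(1) compact show ?thesis using that by blast
qed

text \<open>
  The image of a singular linear map is contained in a hyperplane, hence negligible, and cannot
  contain a nonempty open set.
\<close>

lemma linear_inj_of_open_subset_affine_image:
  fixes L :: "'a::euclidean_space \<Rightarrow> 'a"
  assumes "linear L" "open U" "U \<noteq> {}" "U \<subseteq> (\<lambda>x. L x + b) ` S"
  shows "inj L"
proof (rule ccontr)
  assume "\<not> inj L"
  then have "negligible ((+) b ` L ` S)"
    using assms(1) negligible_linear_singular_image negligible_translation by blast
  moreover have "U \<subseteq> (+) b ` L ` S" using assms(4) by (auto simp: add.commute)
  ultimately show False
    using open_not_negligible[OF assms(2,3)] negligible_subset by blast
qed

text \<open>
  The smallest box that contains the slab \<open>0 \<le> x\<^sub>k \<le> t\<close> of the unbounded cusp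
  \<open>\<bar>x\<^sub>i\<bar> powr \<alpha> i \<le> x\<^sub>k\<close>. Its volume has the same order as that of the slab.
\<close>

definition cusp_box :: "'d \<Rightarrow> ('d \<Rightarrow> real) \<Rightarrow> real \<Rightarrow> (real ^ 'd::finite) set" where
  "cusp_box k \<alpha> t = cbox (\<chi> i. if i = k then 0 else - (t powr (1 / \<alpha> i)))
                        (\<chi> i. if i = k then t else t powr (1 / \<alpha> i))"

lemma compact_cusp_box: "compact (cusp_box k \<alpha> t)"
  by (simp add: cusp_box_def)

lemma ref_domain_coord_bounds:
  assumes "y \<in> ref_domain k \<alpha>"
  shows "0 \<le> y $ k" "y $ k \<le> 1" "i \<noteq> k \<Longrightarrow> \<bar>y $ i\<bar> powr \<alpha> i \<le> y $ k"
proof -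
  let ?F = "insert 0 ((\<lambda>i. \<bar>y $ i\<bar> powr \<alpha> i) ` (- {k}))"
  have M: "Max ?F \<le> y $ k" and "y $ k \<in> {-1..1}" using assms by (auto simp: ref_domain_def)
  then show "y $ k \<le> 1" by simp
  have "finite ?F" by simp
  then have *: "z \<le> y $ k" if "z \<in> ?F" for z
    using M that Max_ge order_trans by blast
  from * show "0 \<le> y $ k" by simp
  from * show "i \<noteq> k \<Longrightarrow> \<bar>y $ i\<bar> powr \<alpha> i \<le> y $ k" by simp
qed

lemma ref_domain_in_cusp_box:
  assumes "y \<in> ref_domain k \<alpha>" "y $ k \<le> t" "\<And>i. i \<noteq> k \<Longrightarrow> 0 < \<alpha> i"
  shows "y \<in> cusp_box k \<alpha> t"
proof -
  have "\<bar>y $ i\<bar> \<le> t powr (1 / \<alpha> i)" if "i \<noteq> k" for i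
  proof -
    have "\<bar>y $ i\<bar> = (\<bar>y $ i\<bar> powr \<alpha> i) powr (1 / \<alpha> i)"
      using assms(3)[OF that] by (simp add: powr_powr)
    also have "\<dots> \<le> t powr (1 / \<alpha> i)"
      using ref_domain_coord_bounds(3)[OF assms(1) that] assms(2,3) that
      by (intro powr_mono2) (auto simp: less_imp_le)
    finally show ?thesis .
  qed
  then show ?thesis
    using ref_domain_coord_bounds(1)[OF assms(1)] assms(2)
    by (auto simp: cusp_box_def mem_box_cart abs_le_iff minus_le_iff)
qed

lemma measure_cusp_box:
  fixes k :: "'d::finite"
  assumes "t > 0"
  shows "measure lborel (cusp_box k \<alpha> t) = 2 ^ (CARD('d) - 1) * t powr (1 + (\<Sum>i\<in>-{k}. 1 / \<alpha> i))"
proof -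
  have "cusp_box k \<alpha> t \<noteq> {}"
    using assms unfolding cusp_box_def by (auto simp: interval_ne_empty_cart)
  then have "measure lborel (cusp_box k \<alpha> t) =
      (\<Prod>i\<in>UNIV. if i = k then t else 2 * t powr (1 / \<alpha> i))"
    unfolding cusp_box_def
    by (subst content_cbox_cart, assumption) (intro prod.cong refl, simp)
  also have "\<dots> = t * (\<Prod>i\<in>-{k}. 2 * t powr (1 / \<alpha> i))"
    by (subst prod.remove[of _ k]) (auto simp: Compl_eq_Diff_UNIV intro!: prod.cong)
  also have "\<dots> = 2 ^ (CARD('d) - 1) * (t * t powr (\<Sum>i\<in>-{k}. 1 / \<alpha> i))"
    using assms by (simp add: prod.distrib powr_sum Compl_eq_Diff_UNIV card_Diff_singleton algebra_simps)
  finally show ?thesis using assms by (simp add: powr_add)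
qed

lemma cusp_measure_bound:
  fixes D :: "(real ^ 'd::finite) set" and L :: "real ^ 'd \<Rightarrow> real ^ 'd"
  assumes "open D" "bounded D" "D \<noteq> {}" "linear L"
  obtains C where
    "\<And>t. t > 0 \<Longrightarrow> (\<lambda>x. L x + b) ` cusp_box k \<alpha> t \<in> sets (uniform_measure lborel D)"
    "\<And>t. t > 0 \<Longrightarrow> measure (uniform_measure lborel D) ((\<lambda>x. L x + b) ` cusp_box k \<alpha> t)
        \<le> C * t powr (1 + (\<Sum>i\<in>-{k}. 1 / \<alpha> i))"
proof -
  obtain c where c: "c \<ge> 0" "\<And>S. compact S \<Longrightarrow> compact ((\<lambda>x. L x + b) ` S)"
    "\<And>S. compact S \<Longrightarrow> measure lborel ((\<lambda>x. L x + b) ` S) = c * measure lborel S"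
    using affine_image_compact_measure[OF assms(4), of b] by blast
  let ?E = "\<lambda>t. (\<lambda>x. L x + b) ` cusp_box k \<alpha> t"
  have cE: "compact (?E t)" for t by (intro c(2) compact_cusp_box)
  note D = emeasure_lborel_open_bounded[OF assms(1,2,3)]
  show ?thesis
  proof (rule that)
    fix t :: real assume t: "t > 0"
    show "?E t \<in> sets (uniform_measure lborel D)" using borel_compact[OF cE] by simp
    have "measure (uniform_measure lborel D) (?E t) = measure lborel (D \<inter> ?E t) / measure lborel D"
      using D borel_compact[OF cE] by (intro measure_uniform_measure) auto
    also have "\<dots> \<le> measure lborel (?E t) / measure lborel D"
    proof (intro divide_right_mono measure_mono_fmeasurable)
      show "?E t \<in> fmeasurable lborel" using fmeasurable_compact[OF cE] .
    qed (use borel_compact[OF cE] assms(1) in auto)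
    also have "measure lborel (?E t) = c * (2 ^ (CARD('d) - 1) * t powr (1 + (\<Sum>i\<in>-{k}. 1 / \<alpha> i)))"
      using c(3)[of "cusp_box k \<alpha> t"] measure_cusp_box[OF t, of k \<alpha>]
      by (simp add: compact_cusp_box)
    finally show "measure (uniform_measure lborel D) (?E t)
        \<le> (c * 2 ^ (CARD('d) - 1) / measure lborel D) * t powr (1 + (\<Sum>i\<in>-{k}. 1 / \<alpha> i))"
      by (simp add: mult_ac)
  qed
qed

section \<open>Integration over dyadic layers\<close>

text \<open>
  Let \<open>f\<close> decay like \<open>(L u)\<^sup>-\<^sup>N\<close> and let the sublevel sets of \<open>u\<close> at height \<open>t\<close> be covered by sets of
  measure at most \<open>C t\<^sup>\<beta>\<close>. On the layer \<open>u \<approx> 2\<^sup>j / L\<close> the integrand is of order \<open>2\<^sup>-\<^sup>j\<^sup>N\<close> and the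
  measure of order \<open>(2\<^sup>j / L)\<^sup>\<beta>\<close>. Since \<open>N\<close> exceeds \<open>\<beta>\<close> by at least 1, the layers
  sum to a geometric series of ratio \<open>1/2\<close>, dominated by the innermost layer \<open>u \<le> 1 / L\<close>.
  The first alternative for \<open>f\<close> admits a remainder that is uniformly small.
\<close>

lemma integral_le_of_dyadic_layers:
  fixes f u :: "'a \<Rightarrow> real" and E :: "real \<Rightarrow> 'a set"
  assumes "prob_space M" "integrable M f"
    and E: "\<And>t. t > 0 \<Longrightarrow> E t \<in> sets M" "\<And>t. t > 0 \<Longrightarrow> measure M (E t) \<le> C * t powr \<beta>"
    and "L \<ge> 1" and N: "\<beta> + 1 \<le> real N"
    and f: "AE x in M. f x \<le> (1 / L) ^ N \<or>
        (0 \<le> u x \<and> u x \<le> 1 \<and> (\<forall>t>0. u x \<le> t \<longrightarrow> x \<in> E t) \<and>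
         f x \<le> 1 \<and> f x * (L * u x) ^ N \<le> 1)"
  shows "(\<integral>x. f x \<partial>M) \<le> (1 + C * 2 ^ (N + 1)) * L powr (- \<beta>)"
proof -
  interpret prob_space M by fact
  have C: "C \<ge> 0" using order_trans[OF measure_nonneg E(2)[of 1]] by simp
  obtain J where J: "L < 2 ^ J" using real_arch_pow[of 2 L] by auto
  define t where "t j = 2 ^ j / L" for j :: nat
  \<comment> \<open>The factor \<open>2 ^ N\<close> pays for bounding \<open>u\<close> on a layer by its lower end \<open>t (j - 1)\<close>.\<close>
  define c where "c j = (2 :: real) ^ N * (1 / 2 ^ j) ^ N" for j :: nat
  define g where "g x = (1 / L) ^ N + (\<Sum>j\<le>J. c j * indicator (E (t j)) x)" for x
  have t: "t j > 0" for j using \<open>L \<ge> 1\<close> by (simp add: t_def)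
  have c: "c j \<ge> 0" for j by (simp add: c_def)
  have term_nonneg: "0 \<le> c j * indicator (E (t j)) x" for j x using c by simp
  have fg: "AE x in M. f x \<le> g x"
    using f
  proof eventually_elim
    case (elim x)
    then show ?case
    proof
      assume "f x \<le> (1 / L) ^ N"
      moreover have "0 \<le> (\<Sum>j\<le>J. c j * indicator (E (t j)) x)"
        by (intro sum_nonneg term_nonneg)
      ultimately show ?thesis unfolding g_def by linarith
    next
      assume *: "0 \<le> u x \<and> u x \<le> 1 \<and> (\<forall>t>0. u x \<le> t \<longrightarrow> x \<in> E t) \<and>
         f x \<le> 1 \<and> f x * (L * u x) ^ N \<le> 1"
      \<comment> \<open>The layer of \<open>x\<close>; the bound \<open>u x \<le> 1\<close> keeps its index within \<open>J\<close>.\<close>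
      define j where "j = (LEAST j. u x \<le> t j)"
      have "1 \<le> t J" using J \<open>L \<ge> 1\<close> by (simp add: t_def)
      then have "u x \<le> t J" using * by linarith
      then have j: "u x \<le> t j" "j \<le> J" unfolding j_def by (rule LeastI, rule Least_le)
      have "f x \<le> c j"
      proof (cases j)
        case 0
        have "f x \<le> 1" using * by blast
        also have "1 \<le> c j" by (simp add: c_def 0)
        finally show ?thesis .
      next
        case (Suc i)
        then have "\<not> u x \<le> t i" unfolding j_def by (metis lessI not_less_Least)
        then have i: "2 ^ i \<le> L * u x" using \<open>L \<ge> 1\<close> by (simp add: t_def field_simps)
        show ?thesis
        proof (cases "f x \<le> 0")
          case True
          with c[of j] show ?thesis by linarith
        next
          case False
          then have "f x * (2 ^ i) ^ N \<le> f x * (L * u x) ^ N"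
            using i by (intro mult_left_mono power_mono) auto
          also have "\<dots> \<le> 1" using * by blast
          finally have "f x \<le> 1 / (2 ^ i) ^ N" by (simp add: field_simps)
          also have "\<dots> = c j" by (simp add: c_def Suc power_divide power_mult_distrib)
          finally show ?thesis .
        qed
      qed
      also have "\<dots> = c j * indicator (E (t j)) x"
      proof -
        have "x \<in> E (t j)" using * j(1) t by blast
        then show ?thesis by simp
      qed
      also have "\<dots> \<le> (\<Sum>j\<le>J. c j * indicator (E (t j)) x)"
        using j(2) term_nonneg by (intro member_le_sum) auto
      also have "\<dots> \<le> g x" using \<open>L \<ge> 1\<close> by (simp add: g_def)
      finally show ?thesis .
    qed
  qed
  have int: "integrable M (\<lambda>x. c j * indicator (E (t j)) x)" for j
    using E(1)[OF t] by (intro integrable_mult_right integrable_real_indicator) (auto simp: emeasure_eq_measure)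
  have int_sum: "integrable M (\<lambda>x. \<Sum>j\<le>J. c j * indicator (E (t j)) x)"
    by (rule Bochner_Integration.integrable_sum) (rule int)
  have "integrable M g"
    unfolding g_def by (rule Bochner_Integration.integrable_add[OF integrable_const int_sum])
  then have "(\<integral>x. f x \<partial>M) \<le> (\<integral>x. g x \<partial>M)"
    using assms(2) fg by (intro integral_mono_AE)
  also have "\<dots> = (\<integral>x. (1 / L) ^ N \<partial>M) + (\<integral>x. (\<Sum>j\<le>J. c j * indicator (E (t j)) x) \<partial>M)"
    unfolding g_def by (rule Bochner_Integration.integral_add[OF integrable_const int_sum])
  also have "\<dots> = (1 / L) ^ N + (\<Sum>j\<le>J. \<integral>x. c j * indicator (E (t j)) x \<partial>M)"
    by (subst Bochner_Integration.integral_sum, rule int) (simp add: prob_space)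
  also have "\<dots> = (1 / L) ^ N + (\<Sum>j\<le>J. c j * measure M (E (t j)))"
    using E(1)[OF t] by (simp add: Int_absorb2 sets.sets_into_space)
  also have "\<dots> \<le> L powr (- \<beta>) + (\<Sum>j\<le>J. C * 2 ^ N * L powr (- \<beta>) * (1 / 2) ^ j)"
  proof (intro add_mono sum_mono)
    have "(1 / L) ^ N = L powr (- real N)"
      using \<open>L \<ge> 1\<close> by (simp add: powr_minus powr_realpow power_divide field_simps)
    also have "\<dots> \<le> L powr (- \<beta>)" using \<open>L \<ge> 1\<close> N by (intro powr_mono) auto
    finally show "(1 / L) ^ N \<le> L powr (- \<beta>)" .
    fix j
    have "(1 / 2 ^ j) ^ N * (2 ^ j) powr \<beta> \<le> (1 / 2 ^ j) ^ N * (2 ^ j :: real) powr (real N - 1)"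
      using N by (intro mult_left_mono powr_mono) auto
    also have "\<dots> = (1 / 2) ^ j"
      by (simp add: powr_diff powr_realpow power_divide)
    finally have *: "(1 / 2 ^ j) ^ N * (2 ^ j) powr \<beta> \<le> (1 / 2 :: real) ^ j" .
    have "c j * measure M (E (t j)) \<le> c j * (C * t j powr \<beta>)"
      using E(2)[OF t] c by (intro mult_left_mono) auto
    also have "\<dots> = C * 2 ^ N * L powr (- \<beta>) * ((1 / 2 ^ j) ^ N * (2 ^ j) powr \<beta>)"
      using \<open>L \<ge> 1\<close> by (simp add: c_def t_def powr_divide powr_minus field_simps)
    also have "\<dots> \<le> C * 2 ^ N * L powr (- \<beta>) * (1 / 2) ^ j"
      using * C by (intro mult_left_mono) auto
    finally show "c j * measure M (E (t j)) \<le> C * 2 ^ N * L powr (- \<beta>) * (1 / 2) ^ j" .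
  qed
  also have "\<dots> = L powr (- \<beta>) + C * 2 ^ N * L powr (- \<beta>) * (\<Sum>j\<le>J. (1 / 2) ^ j)"
    by (simp add: sum_distrib_left)
  also have "\<dots> \<le> L powr (- \<beta>) + C * 2 ^ N * L powr (- \<beta>) * 2"
  proof -
    have "(\<Sum>j\<le>J. (1 / 2 :: real) ^ j) \<le> 2"
      by (subst sum_gp0) auto
    then show ?thesis using C by (intro add_left_mono mult_left_mono) auto
  qed
  finally show ?thesis by (simp add: algebra_simps)
qed

section \<open>The lower bound\<close>

text \<open>
  The product formula for the binomial coefficient has \<open>d\<close> factors \<open>(l + i) / i \<le> l + 1\<close>.
\<close>

lemma binomial_le_Suc_power: "(d + l) choose l \<le> (l + 1) ^ d"
proof (induction d)
  case (Suc d)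
  have "Suc d * (Suc (d + l) choose l) = Suc d * (Suc (d + l) choose Suc d)"
    using binomial_symmetric[of l "Suc (d + l)"] by (simp del: binomial_Suc_Suc)
  also have "\<dots> = Suc (d + l) * ((d + l) choose d)"
    by (rule Suc_times_binomial)
  also have "(d + l) choose d = (d + l) choose l"
    using binomial_symmetric[of l "d + l"] by simp
  also have "Suc (d + l) * ((d + l) choose l) \<le> (Suc d * (l + 1)) * (l + 1) ^ d"
    by (intro mult_mono Suc) auto
  finally have "Suc d * ((Suc d + l) choose l) \<le> Suc d * (l + 1) ^ Suc d"
    by (simp only: power_Suc mult.assoc add_Suc)
  then show ?case by (simp only: Suc_mult_le_cancel1)
qed simp

theorem theorem5p13:
  fixes D :: "(real ^ 'd::finite) set"
    and xbar :: "real ^ 'd"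
    and r1 r2 :: real
    and k :: 'd
    and \<alpha> :: "'d \<Rightarrow> real"
    and A :: "real ^ 'd \<Rightarrow> real ^ 'd"
  assumes "bounded D" and "open D"
    and "xbar \<in> closure D"
    and "0 < r1" and "r1 \<le> r2"
    and "\<And>i. i \<noteq> k \<Longrightarrow> 0 < \<alpha> i \<and> \<alpha> i \<le> 2"
    and "affine_transformation A" and "A 0 = xbar"
    and "D \<subseteq> A ` ref_domain k \<alpha> \<union> (cball xbar r2 - ball xbar r1)"
  shows "\<exists>c>0. \<forall>l n :: nat. n = (CARD('d) + l) choose l \<longrightarrow>
           K_const (poly_space l :: (real ^ 'd \<Rightarrow> real) set) D
             \<ge> ereal (c * real n powr ((2 + (\<Sum>i\<in>- {k}. 2 / \<alpha> i)) / real CARD('d)))"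
proof -
  obtain L b where L: "linear L" "\<And>x. A x = L x + b"
    using assms(7) unfolding affine_transformation_def by blast
  have b: "b = xbar" using L(2)[of 0] assms(8) linear_0[OF L(1)] by simp
  have A: "A = (\<lambda>x. L x + xbar)" using L(2) b by blast
  have "D \<noteq> {}" using assms(3) by auto
  \<comment> \<open>\<open>A\<close> is invertible because its image contains an open piece of \<open>D\<close>.\<close>
  have "D \<inter> ball xbar r1 \<noteq> {}"
    using assms(3,4) by (auto simp: closure_approachable dist_commute disjoint_iff) 
  then have "inj L"
    using linear_inj_of_open_subset_affine_image[OF L(1), of "D \<inter> ball xbar r1" xbar "ref_domain k \<alpha>"]
      assms(2,9) unfolding A by auto
  then obtain h where h: "linear h" "\<And>x. h (L x) = x"
    using linear_injective_isomorphism[OF L(1)] by blast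
  define u where "u x = h (x - xbar) $ k" for x
  have lin_u: "linear (\<lambda>x. h x $ k)"
    using h(1) by (intro linearI) (simp_all add: linear_add linear_scale)
  have u_eq: "u = (\<lambda>x. h x $ k - h xbar $ k)"
    by (simp add: u_def fun_eq_iff linear_diff[OF h(1)])
  have u_poly: "u \<in> poly_space 1"
    unfolding u_eq by (intro poly_space_diff poly_space_linear lin_u poly_space_const)
  have u_A: "u (A y) = y $ k" for y by (simp add: u_def A h(2))

  \<comment> \<open>\<open>B\<close> bounds the exponential growth rate of the kernel on \<open>D\<close>.\<close>
  obtain B where B: "\<And>x. x \<in> D \<Longrightarrow> 3 + 4 * \<bar>u x\<bar> \<le> B"
  proof -
    have "bounded (u ` closure D)"
      using assms(1) continuous_on_poly_space[OF u_poly]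
      by (intro compact_imp_bounded compact_continuous_image) (auto simp: compact_closure)
    then obtain T where "\<And>x. x \<in> closure D \<Longrightarrow> \<bar>u x\<bar> \<le> T"
      unfolding bounded_iff by auto
    then show ?thesis using closure_subset by (intro that[of "3 + 4 * T"]) fastforce
  qed
  have "B > 0" using B \<open>D \<noteq> {}\<close> by fastforce
  obtain R where R: "R \<ge> r1" "\<And>x. x \<in> D \<Longrightarrow> norm (x - xbar) \<le> R"
  proof -
    obtain R0 where "\<And>x. x \<in> D \<Longrightarrow> norm (x - xbar) \<le> R0"
      using assms(1) bounded_any_center[of D xbar] by (auto simp: dist_norm norm_minus_commute)
    then show ?thesis by (intro that[of "max r1 R0"]) (auto intro: le_max_iff_disj[THEN iffD2])
  qed
  \<comment> \<open>The cut-off is 1 at \<open>xbar\<close>, between 0 and 1 on \<open>D\<close> by the choice of \<open>R\<close>, and at most \<open>\<rho> < 1\<close> off the ball of radius \<open>r1\<close>.\<close>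
  define w where "w x = 1 - (norm (x - xbar))\<^sup>2 / R\<^sup>2" for x
  define \<rho> where "\<rho> = 1 - r1\<^sup>2 / R\<^sup>2"
  have "R > 0" using R(1) assms(4) by linarith
  have w: "0 \<le> w x" "w x \<le> 1" if "x \<in> D" for x
    using R(2)[OF that] \<open>R > 0\<close> by (auto simp: w_def power_mono)
  have w_out: "w x \<le> \<rho>" if "r1 \<le> norm (x - xbar)" for x
    using that assms(4) \<open>R > 0\<close> by (auto simp: w_def \<rho>_def intro!: divide_right_mono power_mono)
  have \<rho>: "\<rho> < 1" using assms(4) \<open>R > 0\<close> by (simp add: \<rho>_def)
  have w_poly: "w \<in> poly_space 2"
  proof -
    have "(\<lambda>x. 1 - (1 / R\<^sup>2) * (norm (x - xbar))\<^sup>2) \<in> poly_space 2"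
      by (intro poly_space_diff poly_space_cmult poly_space_norm_square poly_space_const)
    then show ?thesis by (simp add: w_def[abs_def])
  qed

  define \<beta> where "\<beta> = 1 + (\<Sum>i\<in>-{k}. 1 / \<alpha> i)"
  have \<beta>: "2 + (\<Sum>i\<in>-{k}. 2 / \<alpha> i) = 2 * \<beta>" 
    by (simp add: \<beta>_def sum_distrib_left)
  have "(\<Sum>i\<in>-{k}. 1 / \<alpha> i) \<ge> 0"
    using assms(6) by (intro sum_nonneg) (simp add: less_imp_le)
  then have "\<beta> \<ge> 1" by (simp add: \<beta>_def)
  obtain N :: nat where N: "\<beta> + 1 \<le> real N" using real_arch_simple by blast
  then have "N > 0" using \<open>\<beta> \<ge> 1\<close> by (cases N) auto
  \<comment> \<open>A power of the cut-off that beats the growth of the kernel with a factor \<open>2\<^sup>-\<^sup>N\<close> to spare.\<close>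
  obtain M where M: "(2 * B) ^ N * \<rho> ^ M \<le> 1"
  proof -
    have "0 < 1 / (2 * B) ^ N" using \<open>B > 0\<close> by simp
    then obtain M where "\<rho> ^ M < 1 / (2 * B) ^ N" using real_arch_pow_inv \<rho> by blast
    then show ?thesis using \<open>B > 0\<close> by (intro that[of M]) (simp add: field_simps)
  qed
  define W where "W = N + 2 * M"
  have "W > 0" using \<open>N > 0\<close> by (simp add: W_def)

  let ?E = "\<lambda>t. (\<lambda>x. L x + xbar) ` cusp_box k \<alpha> t"
  obtain C where E:
    "\<And>t. t > 0 \<Longrightarrow> ?E t \<in> sets (uniform_measure lborel D)"
    "\<And>t. t > 0 \<Longrightarrow> measure (uniform_measure lborel D) (?E t) \<le> C * t powr \<beta>"
    using cusp_measure_bound[OF assms(2,1) \<open>D \<noteq> {}\<close> L(1)] unfolding \<beta>_def by metis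
  define C' where "C' = 1 + C * 2 ^ (N + 1)"
  have "C \<ge> 0" using order_trans[OF measure_nonneg E(2)[of 1]] by simp
  then have "C' > 0" by (simp add: C'_def add_pos_nonneg)

  have main: "ereal (1 / (C' * (real W powr (2 * \<beta>))) * real n powr (2 * \<beta> / real CARD('d)))
      \<le> K_const (poly_space l :: (real ^ 'd \<Rightarrow> real) set) D"
    if n: "n = (CARD('d) + l) choose l" for l n
  proof -
    \<comment> \<open>The polynomial \<open>v\<close> below has degree at most \<open>W m\<close>.\<close>
    define m where "m = l div W"
    define q where "q = (real m + 1)\<^sup>2"
    have "q \<ge> 1" by (simp add: q_def)
    define v where "v x = (sine_ratio m (u x) / (2 * real m + 1)) ^ N * w x ^ (M * m)" for x
    have v_poly: "v \<in> poly_space l"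
    proof -
      have "(\<lambda>x. ((1 / (2 * real m + 1)) * sine_ratio m (u x)) ^ N * w x ^ (M * m)) \<in> poly_space (N * m + M * m * 2)"
        by (intro poly_space_mult poly_space_power poly_space_cmult poly_space_sine_ratio u_poly w_poly)
      moreover have "N * m + M * m * 2 = W * m" by (simp add: W_def algebra_simps)
      moreover have "W * m \<le> l" by (simp add: m_def)
      ultimately show ?thesis unfolding v_def using poly_space_mono by fastforce
    qed
    have v1: "v xbar = 1"
      using \<open>R > 0\<close> by (simp add: v_def u_def w_def linear_0[OF h(1)] sine_ratio_0)
    have cont: "continuous_on UNIV v" using v_poly by (rule continuous_on_poly_space)
    have v_bound: "(v x)\<^sup>2 \<le> (1 / q) ^ N \<or>
        (0 \<le> u x \<and> u x \<le> 1 \<and> (\<forall>t>0. u x \<le> t \<longrightarrow> x \<in> ?E t) \<and>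
         (v x)\<^sup>2 \<le> 1 \<and> (v x)\<^sup>2 * (q * u x) ^ N \<le> 1)" if x: "x \<in> D" for x
    proof (cases "r1 \<le> norm (x - xbar)")
      case True
      then have "\<bar>w x\<bar> \<le> \<rho>" using w(1)[OF x] w_out by simp
      then show ?thesis
        using peak_polynomial_tail_bound[OF B[OF x] _ M] unfolding v_def q_def by blast
    next
      case False
      then have "x \<notin> cball xbar r2 - ball xbar r1"
        by (simp add: dist_norm norm_minus_commute)
      then obtain y where y: "y \<in> ref_domain k \<alpha>" "x = A y"
        using assms(9) x by blast
      have u: "0 \<le> u x" "u x \<le> 1"
        using ref_domain_coord_bounds[OF y(1)] by (simp_all add: y(2) u_A)
      have "x \<in> ?E t" if "u x \<le> t" for t
        using ref_domain_in_cusp_box[OF y(1), of t] assms(6) that u_A y(2) A by auto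
      moreover have "\<bar>w x\<bar> \<le> 1" using w[OF x] by simp
      ultimately show ?thesis
        using peak_polynomial_core_bound[OF u, of "w x" m N "M * m"] u unfolding v_def q_def by blast
    qed
    have "(L2norm D v)\<^sup>2 \<le> C' * q powr (- \<beta>)"
      unfolding L2norm_square C'_def
    proof (rule integral_le_of_dyadic_layers[OF _ _ E])
      show "prob_space (uniform_measure lborel D)"
        using assms(1,2) \<open>D \<noteq> {}\<close> by (intro prob_space_uniform_measure_open)
      show "integrable (uniform_measure lborel D) (\<lambda>x. (v x)\<^sup>2)"
        using assms(1,2) \<open>D \<noteq> {}\<close> cont
        by (intro integrable_uniform_measure_continuous continuous_intros)
      show "AE x in uniform_measure lborel D. (v x)\<^sup>2 \<le> (1 / q) ^ N \<or>
        (0 \<le> u x \<and> u x \<le> 1 \<and> (\<forall>t>0. u x \<le> t \<longrightarrow> x \<in> ?E t) \<and>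
         (v x)\<^sup>2 \<le> 1 \<and> (v x)\<^sup>2 * (q * u x) ^ N \<le> 1)"
      proof (rule AE_uniform_measureI)
        show "D \<in> sets lborel" using assms(2) by simp
      qed (intro AE_I2 impI, rule v_bound)
    qed (use \<open>q \<ge> 1\<close> N in auto)
    then have K: "ereal (1 / (C' * q powr (- \<beta>))) \<le> K_const (poly_space l) D"
      using K_const_ge_closure[OF assms(2,1,3) v_poly cont v1] by blast

    have "real n \<le> real ((l + 1) ^ CARD('d))"
      unfolding n of_nat_le_iff by (rule binomial_le_Suc_power)
    also have "\<dots> = real (l + 1) powr real CARD('d)" by (simp add: powr_realpow)
    finally have "real n powr (2 * \<beta> / real CARD('d))
        \<le> (real (l + 1) powr real CARD('d)) powr (2 * \<beta> / real CARD('d))"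
      using \<open>\<beta> \<ge> 1\<close> by (intro powr_mono2) auto
    also have "\<dots> = real (l + 1) powr (2 * \<beta>)" by (simp add: powr_powr)
    also have "\<dots> \<le> real (W * (m + 1)) powr (2 * \<beta>)"
    proof (intro powr_mono2)
      have "l + 1 \<le> W * (m + 1)"
        using dividend_less_times_div[OF \<open>W > 0\<close>, of l] by (simp add: m_def)
      then show "real (l + 1) \<le> real (W * (m + 1))" by (simp only: of_nat_le_iff)
    qed (use \<open>\<beta> \<ge> 1\<close> in auto)
    also have "\<dots> = real W powr (2 * \<beta>) * q powr \<beta>"
    proof -
      have "q = (real m + 1) powr 2" by (simp add: q_def)
      then have "q powr \<beta> = (real m + 1) powr (2 * \<beta>)" by (simp only: powr_powr)
      moreover have "real (W * (m + 1)) = real W * (real m + 1)"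
        by (simp add: algebra_simps)
      ultimately show ?thesis using powr_mult[of "real W" "real m + 1" "2 * \<beta>"] by metis
    qed
    finally have "1 / (C' * real W powr (2 * \<beta>)) * real n powr (2 * \<beta> / real CARD('d))
        \<le> 1 / (C' * real W powr (2 * \<beta>)) * (real W powr (2 * \<beta>) * q powr \<beta>)"
      using \<open>C' > 0\<close> by (intro mult_left_mono) auto
    also have "\<dots> = 1 / (C' * q powr (- \<beta>))"
    proof -
      have "real W powr (2 * \<beta>) \<noteq> 0" using \<open>W > 0\<close> by simp
      then show ?thesis using \<open>C' > 0\<close> by (simp add: powr_minus_divide)
    qed
    finally have "ereal (1 / (C' * real W powr (2 * \<beta>)) * real n powr (2 * \<beta> / real CARD('d)))
        \<le> ereal (1 / (C' * q powr (- \<beta>)))" by simp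
    then show ?thesis using K by (rule order_trans)
  qed
  have "1 / (C' * (real W powr (2 * \<beta>))) > 0" using \<open>C' > 0\<close> \<open>W > 0\<close> by simp
  then show ?thesis unfolding \<beta> using main by blast
qed

end
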